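(* Let $X$ and $Y$ be Banach spaces over $\mathbb{K}$ ($\mathbb{K}=\mathbb{R}$ or $\mathbb{C}$), and let $T\in\mathcal{L}(X,Y^* )$. (a) If $T\in\mathrm{QNA}(X,Y^* )$, then $T^\circ\in w^*\mathrm{QNA}(Y,X^* )$. (b) $T^\circ\in\mathrm{NA}(Y,X^* )$ if and only if $T$ weak-star quasi attains its norm towards some $y^*\in\mathrm{NA}(Y,\mathbb{K})$. (c) If $Y$ is separable, then $T^\circ\in\mathrm{QNA}(Y,X^* )$ implies $T\in w^*\mathrm{QNA}(X,Y^* )$.
   Context: Banach spaces are over $\mathbb{K}=\mathbb{R}$ or $\mathbb{C}$. $B_X$ is the closed unit ball of $X$, $X^*=\mathcal{L}(X,\mathbb{K})$ its topological dual, and $\mathcal{L}(X,Y)$ the space of bounded linear operators from $X$ to $Y$ with the operator norm. For $T\in\mathcal{L}(X,Y)$: $T\in\mathrm{NA}(X,Y)$ if there is $x\in B_X$ with $\|Tx\|=\|T\|$; $T\in\mathrm{QNA}(X,Y)$ if the norm closure of $T(B_X)$ intersects $\{y\in Y:\|y\|=\|T\|\}$. For $T\in\mathcal{L}(X,Y^* )$, $T$ weak-star quasi attains its norm towards $y^*\in Y^*$ if $\|y^*\|=\|T\|$ and $y^*$ belongs to the $\sigma(Y^*,Y)$-closure of $T(B_X)$; $T\in w^*\mathrm{QNA}(X,Y^* )$ if it weak-star quasi attains its norm towards some $y^*\in Y^*$. The transposition $T^\circ\in\mathcal{L}(Y,X^* )$ of $T\in\mathcal{L}(X,Y^* )$ is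 defined by $[T^\circ y](x)=[Tx](y)$ for all $y\in Y$, $x\in X$. *)

theory Defs
  imports "HOL-Analysis.Analysis"
begin

text \<open>
  The scalar fields: normed fields that are, via an isometric isomorphism, the real numbers or
  the complex numbers. (Multiplicativity and \<open>\<phi> \<noteq> 0\<close> give \<open>\<phi> 1 = 1\<close>.)
\<close>

class real_or_complex = real_normed_field +
  assumes real_or_complex:
    "\<exists>\<phi> :: 'a \<Rightarrow> complex.
       (\<forall>a b. \<phi> (a + b) = \<phi> a + \<phi> b) \<and> (\<forall>a b. \<phi> (a * b) = \<phi> a * \<phi> b) \<and>
       (\<forall>r a. \<phi> (r *\<^sub>R a) = r *\<^sub>R \<phi> a) \<and> (\<forall>a. cmod (\<phi> a) = norm a) \<and>
       (range \<phi> = \<real> \<or> range \<phi> = UNIV)"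

instance real :: real_or_complex
  by standard (rule exI[of _ complex_of_real], auto simp: Reals_def scaleR_conv_of_real)

instance complex :: real_or_complex
  by standard (rule exI[of _ "\<lambda>z. z"], auto)

text \<open>
  A normed space over \<open>'k\<close> is a real normed space with a compatible scalar multiplication by
  \<open>'k\<close>; it is a Banach space over \<open>'k\<close> if the underlying type is in class \<open>banach\<close>.
\<close>

locale normed_space_over = vector_space scale
  for scale :: "'k::real_or_complex \<Rightarrow> 'a::real_normed_vector \<Rightarrow> 'a" +
  assumes norm_scale: "norm (scale c x) = norm c * norm x"
    and scale_of_real: "scale (of_real r) x = r *\<^sub>R x"

text \<open>
  The \<open>'k\<close>-linear bounded operators from the space with scalar multiplication \<open>sX\<close> to the subspace
  \<open>Z\<close> of the space with scalar multiplication \<open>sZ\<close>. A subspace is allowed as codomain because a dual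
  space is not a type of its own: it is the set of those real-linear bounded maps
  \<open>'a \<Rightarrow>\<^sub>L 'k\<close> that are \<open>'k\<close>-linear.
\<close>

definition bounded_ops ::
  "('k::real_or_complex \<Rightarrow> 'a::real_normed_vector \<Rightarrow> 'a) \<Rightarrow> 'b set \<Rightarrow>
   ('k \<Rightarrow> 'b::real_normed_vector \<Rightarrow> 'b) \<Rightarrow> ('a \<Rightarrow>\<^sub>L 'b) set" where
  "bounded_ops sX Z sZ =
     {T. Vector_Spaces.linear sX sZ (blinfun_apply T) \<and> range (blinfun_apply T) \<subseteq> Z}"

definition dual ::
  "('k::real_or_complex \<Rightarrow> 'a::real_normed_vector \<Rightarrow> 'a) \<Rightarrow> ('a \<Rightarrow>\<^sub>L 'k) set" where
  "dual sX = bounded_ops sX UNIV (*)"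

definition dual_scale ::
  "'k::real_or_complex \<Rightarrow> ('a::real_normed_vector \<Rightarrow>\<^sub>L 'k) \<Rightarrow> ('a \<Rightarrow>\<^sub>L 'k)" where
  "dual_scale c f = blinfun_mult_right c o\<^sub>L f"

definition NA ::
  "('k::real_or_complex \<Rightarrow> 'a::real_normed_vector \<Rightarrow> 'a) \<Rightarrow> 'b set \<Rightarrow>
   ('k \<Rightarrow> 'b::real_normed_vector \<Rightarrow> 'b) \<Rightarrow> ('a \<Rightarrow>\<^sub>L 'b) set" where
  "NA sX Z sZ = {T \<in> bounded_ops sX Z sZ. \<exists>x\<in>cball 0 1. norm (T x) = norm T}"

definition QNA ::
  "('k::real_or_complex \<Rightarrow> 'a::real_normed_vector \<Rightarrow> 'a) \<Rightarrow> 'b set \<Rightarrow>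
   ('k \<Rightarrow> 'b::real_normed_vector \<Rightarrow> 'b) \<Rightarrow> ('a \<Rightarrow>\<^sub>L 'b) set" where
  "QNA sX Z sZ = {T \<in> bounded_ops sX Z sZ.
     closure (blinfun_apply T ` cball 0 1) \<inter> {z \<in> Z. norm z = norm T} \<noteq> {}}"

text \<open>
  \<open>\<sigma>(X\<^sup>*, X)\<close>: the coarsest topology on the dual making all evaluations continuous, that is, the
  topology of pointwise convergence pulled back from the product of copies of \<open>'k\<close>.
\<close>

definition weak_star_topology ::
  "('k::real_or_complex \<Rightarrow> 'a::real_normed_vector \<Rightarrow> 'a) \<Rightarrow> ('a \<Rightarrow>\<^sub>L 'k) topology" where
  "weak_star_topology sX =
     pullback_topology (dual sX) blinfun_apply (product_topology (\<lambda>_. euclidean) UNIV)"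

definition weak_star_quasi_attains_towards ::
  "('k::real_or_complex \<Rightarrow> 'b::real_normed_vector \<Rightarrow> 'b) \<Rightarrow>
   ('a::real_normed_vector \<Rightarrow>\<^sub>L ('b \<Rightarrow>\<^sub>L 'k)) \<Rightarrow> ('b \<Rightarrow>\<^sub>L 'k) \<Rightarrow> bool" where
  "weak_star_quasi_attains_towards sY T g \<longleftrightarrow>
     g \<in> dual sY \<and> norm g = norm T \<and>
     g \<in> weak_star_topology sY closure_of (blinfun_apply T ` cball 0 1)"

definition weak_star_QNA ::
  "('k::real_or_complex \<Rightarrow> 'a::real_normed_vector \<Rightarrow> 'a) \<Rightarrow>
   ('k \<Rightarrow> 'b::real_normed_vector \<Rightarrow> 'b) \<Rightarrow> ('a \<Rightarrow>\<^sub>L ('b \<Rightarrow>\<^sub>L 'k)) set" where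
  "weak_star_QNA sX sY = {T \<in> bounded_ops sX (dual sY) dual_scale.
     \<exists>g\<in>dual sY. weak_star_quasi_attains_towards sY T g}"

definition transposition ::
  "('a::real_normed_vector \<Rightarrow>\<^sub>L ('b::real_normed_vector \<Rightarrow>\<^sub>L 'k::real_or_complex)) \<Rightarrow>
   ('b \<Rightarrow>\<^sub>L ('a \<Rightarrow>\<^sub>L 'k))" where
  "transposition T = Blinfun (\<lambda>y. Blinfun (\<lambda>x. T x y))"

text \<open>
  The arguments of \<open>Blinfun\<close> above are bounded linear maps, so the transposition is given by the
  expected formula; moreover it preserves \<open>'k\<close>-linearity.
\<close>

lemma transposition_apply: "transposition T y x = T x y"
proof -
  have bl: "bounded_linear (\<lambda>x. T x y)" for y
    by (rule bounded_linear_compose[OF blinfun.bounded_linear_left blinfun.bounded_linear_right])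
  have app: "blinfun_apply (Blinfun (\<lambda>x. T x y)) x = T x y" for x y
    by (rule bounded_linear_Blinfun_apply[OF bl, THEN fun_cong])
  have "bounded_linear (\<lambda>y. Blinfun (\<lambda>x. T x y))"
  proof (rule bounded_linear_intro[where K = "norm T"])
    fix y
    show "norm (Blinfun (\<lambda>x. T x y)) \<le> norm y * norm T"
    proof (rule norm_blinfun_bound)
      fix x
      have "norm (T x y) \<le> norm (T x) * norm y" by (rule norm_blinfun)
      also have "\<dots> \<le> (norm T * norm x) * norm y"
        by (intro mult_right_mono norm_blinfun) auto
      finally show "norm (blinfun_apply (Blinfun (\<lambda>x. T x y)) x) \<le> norm y * norm T * norm x"
        by (simp add: app mult_ac)
    qed simp
  qed (rule blinfun_eqI, simp only: app blinfun.add_left blinfun.scaleR_left,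
      simp only: blinfun.add_right blinfun.scaleR_right)+
  then show ?thesis
    unfolding transposition_def by (simp add: bounded_linear_Blinfun_apply app)
qed

lemma normed_space_over_dual_scale:
  "normed_space_over (dual_scale :: 'k::real_or_complex \<Rightarrow> ('a::real_normed_vector \<Rightarrow>\<^sub>L 'k) \<Rightarrow> _)"
proof
  fix c :: 'k and f :: "'a \<Rightarrow>\<^sub>L 'k"
  have le: "norm (dual_scale c f) \<le> norm c * norm f" for c :: 'k and f :: "'a \<Rightarrow>\<^sub>L 'k"
  proof (rule norm_blinfun_bound)
    fix x
    show "norm (dual_scale c f x) \<le> norm c * norm f * norm x"
      using mult_left_mono[OF norm_blinfun[of f x] norm_ge_zero[of c]]
      by (simp add: dual_scale_def norm_mult mult.assoc)
  qed simp
  show "norm (dual_scale c f) = norm c * norm f"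
  proof (cases "c = 0")
    case True
    then show ?thesis using le[of c f] by simp
  next
    case False
    have "f = dual_scale (inverse c) (dual_scale c f)"
      by (rule blinfun_eqI) (use False in \<open>simp add: dual_scale_def\<close>)
    with le[of "inverse c" "dual_scale c f"]
    have "norm f \<le> inverse (norm c) * norm (dual_scale c f)"
      by (simp add: norm_inverse)
    with False have "norm c * norm f \<le> norm (dual_scale c f)"
      by (simp add: field_simps)
    with le[of c f] show ?thesis by simp
  qed
qed (auto intro!: blinfun_eqI
    simp: dual_scale_def blinfun.bilinear_simps algebra_simps scaleR_conv_of_real)

lemma transposition_in_bounded_ops:
  assumes "normed_space_over sX" "normed_space_over sY"
    and T: "T \<in> bounded_ops sX (dual sY) dual_scale"
  shows "transposition T \<in> bounded_ops sY (dual sX) dual_scale"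
proof -
  interpret X: normed_space_over sX by fact
  interpret Y: normed_space_over sY by fact
  interpret D: normed_space_over "dual_scale :: 'a \<Rightarrow> ('b \<Rightarrow>\<^sub>L 'a) \<Rightarrow> _"
    by (rule normed_space_over_dual_scale)
  have vs: "vector_space ((*) :: 'a \<Rightarrow> 'a \<Rightarrow> 'a)"
    by standard (auto simp: algebra_simps)
  have lin: "T (sX c x) = dual_scale c (T x)" for c x
    using T by (simp add: bounded_ops_def Vector_Spaces.linear_iff)
  have linY: "T x (sY c y) = c * T x y" for x c y
  proof -
    have "Vector_Spaces.linear sY (*) (blinfun_apply (T x))"
      using T by (auto simp: bounded_ops_def dual_def)
    then show ?thesis by (simp add: Vector_Spaces.linear_iff)
  qed
  have "transposition T y \<in> dual sX" for y
    unfolding dual_def bounded_ops_def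
    using vs X.vector_space_axioms
    by (auto simp: vector_space_pair_def transposition_apply
        blinfun.bilinear_simps lin dual_scale_def Vector_Spaces.linear_iff)
  moreover have "Vector_Spaces.linear sY dual_scale (blinfun_apply (transposition T))"
    using Y.vector_space_axioms D.vector_space_axioms
    by (auto intro!: blinfun_eqI simp: Vector_Spaces.linear_iff vector_space_pair_def
        transposition_apply blinfun.bilinear_simps linY dual_scale_def)
  ultimately show ?thesis by (auto simp: bounded_ops_def)
qed

end

theory Submission
  imports Defs
begin

text \<open>
  Let \<open>f \<in> Y\<^sup>*\<close>. Choose \<open>y\<^sub>n \<in> B\<^sub>Y\<close> with \<open>f y\<^sub>n \<rightarrow> \<parallel>f\<parallel>\<close> and let \<open>g\<close> be a weak-star cluster point of
  the images of the \<open>y\<^sub>n\<close> under the transposition of \<open>T\<close> (Banach--Alaoglu). Since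
  \<open>\<bar>T x y\<^sub>n - f y\<^sub>n\<bar> \<le> \<parallel>T x - f\<parallel>\<close> for every \<open>n\<close>, in the limit \<open>\<bar>g x - \<parallel>f\<parallel>\<bar> \<le> \<parallel>T x - f\<parallel>\<close>.
  If \<open>f\<close> has norm \<open>\<parallel>T\<parallel>\<close> and is approximated by \<open>T x\<close> with \<open>x \<in> B\<^sub>X\<close>, this gives \<open>\<parallel>g\<parallel> = \<parallel>T\<parallel>\<close>; if \<open>f = T x\<close>,
  then \<open>g\<close> attains its norm at \<open>x\<close>. As transposing twice gives back \<open>T\<close>, part (c) is part (a) for
  the transposition.
\<close>

section \<open>Compact scalar balls and the weak-star topology as pointwise convergence\<close>

text \<open>The map \<open>\<phi>\<close> is an isometry onto a closed subset of the complex plane,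
  where bounded closed sets are compact; its inverse, again isometric, carries compactness
  back.\<close>

lemma compact_cball_real_or_complex:
  fixes a :: "'k::real_or_complex"
  shows "compact (cball a r)"
proof -
  obtain \<phi> :: "'k \<Rightarrow> complex" where add: "\<And>a b. \<phi> (a + b) = \<phi> a + \<phi> b"
    and norm: "\<And>a. cmod (\<phi> a) = norm a" and range: "range \<phi> = \<real> \<or> range \<phi> = UNIV"
    using real_or_complex[where 'a = 'k] by blast
  have "\<phi> (a - b) = \<phi> a - \<phi> b" for a b
    using add[of "a - b" b] by simp
  then have dist: "dist (\<phi> a) (\<phi> b) = dist a b" for a b
    by (metis dist_norm norm)
  then have inj: "inj \<phi>"
    by (metis dist_eq_0_iff injI)
  have "closed (range \<phi>)"
    using range closed_complex_Reals by auto
  then have "compact (range \<phi> \<inter> cball (\<phi> a) r)"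
    by (simp add: closed_Int_compact)
  also have "range \<phi> \<inter> cball (\<phi> a) r = \<phi> ` cball a r"
    using dist by auto
  finally have "compact (\<phi> ` cball a r)" .
  moreover have "continuous_on (\<phi> ` cball a r) (inv \<phi>)"
    unfolding continuous_on_iff using inj by (auto simp: dist)
  ultimately have "compact (inv \<phi> ` \<phi> ` cball a r)"
    by (rule compact_continuous_image[rotated])
  then show ?thesis
    by (simp add: image_image inj)
qed

text \<open>Additivity is built into the type of bounded operators, so only homogeneity over
  \<open>'k\<close> remains.\<close>

lemma dual_iff:
  fixes sX :: "'k::real_or_complex \<Rightarrow> 'x::real_normed_vector \<Rightarrow> 'x"
  assumes "normed_space_over sX"
  shows "f \<in> dual sX \<longleftrightarrow> (\<forall>c x. f (sX c x) = c * f x)"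
proof -
  interpret normed_space_over sX by fact
  have "vector_space ((*) :: 'k \<Rightarrow> 'k \<Rightarrow> 'k)"
    by standard (auto simp: algebra_simps)
  then show ?thesis
    using vector_space_axioms
    by (auto simp: dual_def bounded_ops_def Vector_Spaces.linear_iff vector_space_pair_def
        blinfun.bilinear_simps)
qed

lemma openin_weak_star_topology:
  "openin (weak_star_topology sX) U \<longleftrightarrow>
     (\<exists>V. open V \<and> U = blinfun_apply -` V \<inter> dual sX)"
  by (simp add: weak_star_topology_def openin_pullback_topology euclidean_product_topology)

lemma topspace_weak_star_topology: "topspace (weak_star_topology sX) = dual sX"
  by (simp add: weak_star_topology_def topspace_pullback_topology euclidean_product_topology)

text \<open>The topology is pulled back from a product, so closures can be taken in the function
  type. The intersection with \<open>dual sX\<close> appears because \<open>closure_of\<close> sees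
  only members of the carrier.\<close>

lemma in_weak_star_closure_iff:
  "g \<in> weak_star_topology sX closure_of S \<longleftrightarrow>
     g \<in> dual sX \<and> blinfun_apply g \<in> closure (blinfun_apply ` (S \<inter> dual sX))"
proof (intro iffI conjI)
  assume g: "g \<in> weak_star_topology sX closure_of S"
  show "g \<in> dual sX"
    using g unfolding in_closure_of topspace_weak_star_topology by (rule conjunct1)
  show "blinfun_apply g \<in> closure (blinfun_apply ` (S \<inter> dual sX))"
    unfolding closure_iff_nhds_not_empty
  proof (intro allI impI)
    fix A V assume V: "V \<subseteq> A" "open V" "blinfun_apply g \<in> V"
    have "openin (weak_star_topology sX) (blinfun_apply -` V \<inter> dual sX)"
      using V(2) unfolding openin_weak_star_topology by (intro exI[of _ V] conjI refl)
    moreover have "g \<in> blinfun_apply -` V \<inter> dual sX"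
      using V(3) \<open>g \<in> dual sX\<close> by simp
    ultimately obtain f where "f \<in> S" "f \<in> blinfun_apply -` V \<inter> dual sX"
      using g unfolding in_closure_of by meson
    then have "blinfun_apply f \<in> blinfun_apply ` (S \<inter> dual sX) \<inter> A"
      using V(1) by (intro IntI imageI) auto
    then show "blinfun_apply ` (S \<inter> dual sX) \<inter> A \<noteq> {}"
      by (rule ex_in_conv[THEN iffD1, OF exI])
  qed
next
  assume g: "g \<in> dual sX \<and> blinfun_apply g \<in> closure (blinfun_apply ` (S \<inter> dual sX))"
  show "g \<in> weak_star_topology sX closure_of S"
    unfolding in_closure_of topspace_weak_star_topology
  proof (intro conjI allI impI)
    show "g \<in> dual sX" using g by (rule conjunct1)
    fix U assume U: "g \<in> U \<and> openin (weak_star_topology sX) U"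
    then obtain V where V: "open V" "U = blinfun_apply -` V \<inter> dual sX"
      by (auto simp: openin_weak_star_topology)
    then have "blinfun_apply g \<in> V" using U by simp
    then have "blinfun_apply ` (S \<inter> dual sX) \<inter> V \<noteq> {}"
      using g V(1) unfolding closure_iff_nhds_not_empty by (meson order_refl)
    with V(2) show "\<exists>f. f \<in> S \<and> f \<in> U" by auto
  qed
qed

section \<open>Weak-star compactness and cluster points\<close>

text \<open>By Tychonoff a product of scalar balls is compact, and the linear functions form a
  closed set. The image under \<open>blinfun_apply\<close> is taken because compactness refers to
  the product topology, while the operator type carries the norm topology.\<close>

lemma Banach_Alaoglu:
  fixes sX :: "'k::real_or_complex \<Rightarrow> 'x::real_normed_vector \<Rightarrow> 'x"
  assumes X: "normed_space_over sX"
  shows "compact (blinfun_apply ` {f \<in> dual sX. norm f \<le> r})"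
proof (cases "r \<ge> 0")
  case True
  interpret normed_space_over sX by fact
  define P :: "('x \<Rightarrow> 'k) set" where "P = PiE UNIV (\<lambda>x. cball 0 (r * norm x))"
  define L where "L = {h :: 'x \<Rightarrow> 'k. (\<forall>x y. h (x + y) = h x + h y) \<and> (\<forall>c x. h (sX c x) = c * h x)}"
  have "compactin (product_topology (\<lambda>_. euclidean) UNIV) P"
    unfolding P_def by (subst compactin_PiE) (auto simp: compact_cball_real_or_complex)
  then have "compact P"
    by (simp add: euclidean_product_topology)
  \<comment> \<open>Each linearity condition equates two expressions that depend continuously on
    \<open>h\<close>, evaluations being continuous.\<close>
  moreover have "closed L"
    unfolding L_def
    by (intro closed_Collect_conj closed_Collect_all closed_Collect_eq continuous_intros
        continuous_on_product_coordinates)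
  ultimately have "compact (P \<inter> L)"
    by (rule compact_Int_closed)
  also have "P \<inter> L = blinfun_apply ` {f \<in> dual sX. norm f \<le> r}"
  proof (intro equalityI subsetI)
    fix h assume h: "h \<in> P \<inter> L"
    have "bounded_linear h"
    proof (rule bounded_linear_intro[where K = r])
      \<comment> \<open>\<open>L\<close> asks for homogeneity over \<open>'k\<close>; real scalars
        enter it through \<open>of_real\<close>.\<close>
      show "h (a *\<^sub>R x) = a *\<^sub>R h x" for a x
        using h by (simp add: L_def scale_of_real[symmetric] scaleR_conv_of_real)
    qed (use h in \<open>auto simp: P_def L_def PiE_iff mult.commute\<close>)
    then have app: "blinfun_apply (Blinfun h) = h"
      by (rule bounded_linear_Blinfun_apply)
    have "norm (Blinfun h) \<le> r"
      using h True by (intro norm_blinfun_bound) (auto simp: app P_def PiE_iff)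
    moreover have "Blinfun h \<in> dual sX"
      using h by (simp add: dual_iff[OF X] app L_def)
    ultimately show "h \<in> blinfun_apply ` {f \<in> dual sX. norm f \<le> r}"
      using app by (metis (mono_tags, lifting) imageI mem_Collect_eq)
  next
    fix h assume "h \<in> blinfun_apply ` {f \<in> dual sX. norm f \<le> r}"
    then obtain f where f: "h = blinfun_apply f" "f \<in> dual sX" "norm f \<le> r" by blast
    have "norm (f x) \<le> r * norm x" for x
      using norm_blinfun[of f x] mult_right_mono[OF f(3) norm_ge_zero[of x]] by linarith
    then show "h \<in> P \<inter> L"
      using f by (auto simp: P_def L_def dual_iff[OF X] blinfun.bilinear_simps)
  qed
  finally show ?thesis .
next
  case False
  then have "{f \<in> dual sX. norm f \<le> r} = {}"
    by (auto intro: order_trans[OF norm_ge_zero])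
  then show ?thesis by (simp only: image_empty compact_empty)
qed

text \<open>A compact space of functions may lack convergent subsequences, so a cluster point of the
  image filter replaces the limit. Its membership in closed sets that eventually contain the
  sequence is what carries inequalities to the limit.\<close>

lemma compact_closed_cluster_point:
  assumes "compact K" and "\<And>n::nat. h n \<in> K"
  obtains l where "l \<in> K" and "\<And>S. closed S \<Longrightarrow> \<forall>\<^sub>F n in sequentially. h n \<in> S \<Longrightarrow> l \<in> S"
proof -
  have "\<forall>\<^sub>F z in filtermap h sequentially. z \<in> K"
    using assms(2) by (simp add: eventually_filtermap)
  then obtain l where l: "l \<in> K" "inf (nhds l) (filtermap h sequentially) \<noteq> bot"
    using assms(1) unfolding compact_filter by (metis filtermap_bot_iff sequentially_bot)
  have "l \<in> S" if S: "closed S" "\<forall>\<^sub>F n in sequentially. h n \<in> S" for S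
  proof (rule ccontr)
    assume "l \<notin> S"
    then have "\<forall>\<^sub>F z in nhds l. z \<in> - S"
      using S(1) by (intro eventually_nhds_in_open) auto
    moreover have "\<forall>\<^sub>F z in filtermap h sequentially. z \<in> S"
      using S(2) by (simp add: eventually_filtermap)
    ultimately have "\<forall>\<^sub>F z in inf (nhds l) (filtermap h sequentially). False"
      unfolding eventually_inf by blast
    with l(2) show False by (simp add: trivial_limit_def)
  qed
  with l(1) that show thesis by blast
qed

section \<open>Norming sequences\<close>

text \<open>Unimodular scalars rotate the values at nearly norming vectors to nonnegative reals, so
  the values converge and not just their moduli.\<close>

lemma dual_norming_sequence:
  fixes sY :: "'k::real_or_complex \<Rightarrow> 'y::real_normed_vector \<Rightarrow> 'y"
  assumes Y: "normed_space_over sY" and f: "f \<in> dual sY"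
  obtains y where "\<And>n::nat. norm (y n) \<le> 1" and "(\<lambda>n. f (y n)) \<longlonglongrightarrow> of_real (norm f)"
proof -
  interpret normed_space_over sY by fact
  have "\<exists>y. norm y \<le> 1 \<and> norm (f y - of_real (norm f)) \<le> e" if e: "e > 0" for e
  proof -
    have "\<exists>z. norm z \<le> 1 \<and> norm (f z) > norm f - e"
    proof (rule ccontr)
      assume "\<not> ?thesis"
      then have le: "norm (f z) \<le> norm f - e" if "norm z \<le> 1" for z
        using that by force
      \<comment> \<open>By homogeneity the bound on the unit ball becomes an operator bound.\<close>
      have "norm f \<le> norm f - e"
      proof (rule norm_blinfun_bound)
        show "0 \<le> norm f - e" using le[of 0] by simp
        show "norm (f z) \<le> (norm f - e) * norm z" for z
        proof (cases "z = 0")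
          case False
          then have "norm (f (z /\<^sub>R norm z)) \<le> norm f - e" by (intro le) simp
          with False show ?thesis by (simp add: blinfun.scaleR_right field_simps)
        qed simp
      qed
      with e show False by simp
    qed
    then obtain z where z: "norm z \<le> 1" "norm (f z) > norm f - e" by blast
    show ?thesis
    proof (cases "f z = 0")
      \<comment> \<open>Here \<open>norm f < e\<close>, so the value 0 is already close
        enough.\<close>
      case True
      with z show ?thesis by (intro exI[of _ z]) simp
    next
      case False
      \<comment> \<open>Scaling \<open>z\<close> by \<open>c\<close> keeps its norm and turns
        \<open>f z\<close> into its modulus.\<close>
      define c where "c = of_real (norm (f z)) / f z"
      have "norm c = 1" using False by (simp add: c_def norm_divide)
      moreover have "f (sY c z) = of_real (norm (f z))"
        using f False by (simp add: dual_iff[OF Y] c_def)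
      moreover have "norm (f z) \<le> norm f"
        using norm_blinfun[of f z] mult_left_mono[OF z(1) norm_ge_zero[of f]] by simp
      ultimately show ?thesis
        using z by (intro exI[of _ "sY c z"]) (simp add: norm_scale flip: of_real_diff)
    qed
  qed
  then have "\<forall>n. \<exists>y. norm y \<le> 1 \<and> norm (f y - of_real (norm f)) \<le> inverse (real (Suc n))"
    by simp
  then obtain y where y: "\<And>n. norm (y n) \<le> 1"
    "\<And>n. norm (f (y n) - of_real (norm f)) \<le> inverse (real (Suc n))"
    by metis
  have "(\<lambda>n. f (y n) - of_real (norm f)) \<longlonglongrightarrow> 0"
    by (rule Lim_null_comparison[OF _ LIMSEQ_inverse_real_of_nat]) (use y in auto)
  with y(1) that show thesis by (metis LIM_zero_iff)
qed

section \<open>The norm of the transposition and the limiting functional\<close>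

lemma transposition_transposition [simp]: "transposition (transposition T) = T"
  by (intro blinfun_eqI) (simp add: transposition_apply)

lemma norm_transposition_le: "norm (transposition T) \<le> norm T"
proof (intro norm_blinfun_bound)
  fix x y
  have "norm (T x y) \<le> norm (T x) * norm y" by (rule norm_blinfun)
  also have "\<dots> \<le> (norm T * norm x) * norm y"
    by (intro mult_right_mono norm_blinfun) auto
  finally show "norm (transposition T y x) \<le> norm T * norm y * norm x"
    by (simp add: transposition_apply mult_ac)
qed auto

lemma norm_transposition [simp]: "norm (transposition T) = norm T"
  using norm_transposition_le[of T] norm_transposition_le[of "transposition T"] by simp

lemma norm_blinfun_le_on_cball: "norm x \<le> 1 \<Longrightarrow> norm (blinfun_apply T x) \<le> norm T"
  using norm_blinfun[of T x] mult_left_mono[of "norm x" 1 "norm T"] by simp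

text \<open>A single \<open>g\<close> obeys the estimate at every \<open>x\<close>, so it serves
  both an \<open>f\<close> approximated by values of \<open>T\<close> and an \<open>f\<close> equal
  to one of them.\<close>

lemma transposition_weak_star_cluster_point:
  fixes sX :: "'k::real_or_complex \<Rightarrow> 'x::real_normed_vector \<Rightarrow> 'x"
    and sY :: "'k \<Rightarrow> 'y::real_normed_vector \<Rightarrow> 'y"
  assumes X: "normed_space_over sX" and Y: "normed_space_over sY"
    and T: "T \<in> bounded_ops sX (dual sY) dual_scale" and f: "f \<in> dual sY"
  obtains g where "g \<in> weak_star_topology sX closure_of (blinfun_apply (transposition T) ` cball 0 1)"
    and "norm g \<le> norm T" and "\<And>x. norm (g x - of_real (norm f)) \<le> norm (T x - f)"
proof -
  let ?S = "transposition T"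
  have S: "?S y \<in> dual sX" for y
    using transposition_in_bounded_ops[OF X Y T] by (auto simp: bounded_ops_def)
  obtain y where y: "\<And>n::nat. norm (y n) \<le> 1" and lim: "(\<lambda>n. f (y n)) \<longlonglongrightarrow> of_real (norm f)"
    using dual_norming_sequence[OF Y f] by blast
  have "norm (?S (y n)) \<le> norm T" for n
    using norm_blinfun_le_on_cball[OF y, of ?S n] by simp
  then have "blinfun_apply (?S (y n)) \<in> blinfun_apply ` {g \<in> dual sX. norm g \<le> norm T}" for n
    using S by blast
  with Banach_Alaoglu[OF X] obtain h
    where h: "h \<in> blinfun_apply ` {g \<in> dual sX. norm g \<le> norm T}"
      and cl: "\<And>S. closed S \<Longrightarrow> \<forall>\<^sub>F n in sequentially. blinfun_apply (?S (y n)) \<in> S \<Longrightarrow> h \<in> S"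
    by (rule compact_closed_cluster_point) (rule that)
  from h obtain g where g: "h = blinfun_apply g" "g \<in> dual sX" "norm g \<le> norm T" by blast
  \<comment> \<open>This closure is a closed set containing every term of the sequence.\<close>
  have "h \<in> closure (blinfun_apply ` (blinfun_apply ?S ` cball 0 1 \<inter> dual sX))"
    by (rule cl) (use y S in \<open>auto intro!: always_eventually subsetD[OF closure_subset]\<close>)
  with g have "g \<in> weak_star_topology sX closure_of (blinfun_apply ?S ` cball 0 1)"
    by (simp add: in_weak_star_closure_iff)
  moreover have "norm (g x - of_real (norm f)) \<le> norm (T x - f)" for x
  proof (rule field_le_epsilon)
    fix e :: real assume "e > 0"
    \<comment> \<open>The slack \<open>e\<close> absorbs the distance of \<open>f (y n)\<close> from
      its limit, so all late terms lie in \<open>?C\<close>.\<close>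
    let ?C = "{k. norm (k x - of_real (norm f)) \<le> norm (T x - f) + e}"
    have "closed ?C"
      by (intro closed_Collect_le continuous_intros continuous_on_product_coordinates)
    moreover have "\<forall>\<^sub>F n in sequentially. blinfun_apply (?S (y n)) \<in> ?C"
      using tendstoD[OF lim \<open>e > 0\<close>]
    proof eventually_elim
      case (elim n)
      have "norm (T x (y n) - f (y n)) \<le> norm (T x - f)"
        using norm_blinfun_le_on_cball[OF y, of "T x - f" n] by (simp add: blinfun.diff_left)
      moreover have "norm (T x (y n) - of_real (norm f)) \<le>
          norm (T x (y n) - f (y n)) + norm (f (y n) - of_real (norm f))"
        using norm_triangle_ineq[of "T x (y n) - f (y n)" "f (y n) - of_real (norm f)"] by simp
      ultimately show ?case
        using elim by (simp add: transposition_apply dist_norm)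
    qed
    ultimately have "h \<in> ?C" by (rule cl)
    then show "norm (g x - of_real (norm f)) \<le> norm (T x - f) + e"
      by (simp add: g(1))
  qed
  ultimately show thesis using that g(3) by blast
qed

section \<open>Quasi-attainment and attainment by the transposition\<close>

lemma QNA_imp_transposition_weak_star_QNA:
  fixes sX :: "'k::real_or_complex \<Rightarrow> 'x::real_normed_vector \<Rightarrow> 'x"
    and sY :: "'k \<Rightarrow> 'y::real_normed_vector \<Rightarrow> 'y"
  assumes X: "normed_space_over sX" and Y: "normed_space_over sY"
    and T: "T \<in> QNA sX (dual sY) dual_scale"
  shows "transposition T \<in> weak_star_QNA sY sX"
proof -
  have T': "T \<in> bounded_ops sX (dual sY) dual_scale"
    using T by (simp add: QNA_def)
  obtain f where f: "f \<in> dual sY" "norm f = norm T" "f \<in> closure (blinfun_apply T ` cball 0 1)"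
    using T by (auto simp: QNA_def)
  obtain g where g: "g \<in> weak_star_topology sX closure_of (blinfun_apply (transposition T) ` cball 0 1)"
    "norm g \<le> norm T" "\<And>x. norm (g x - of_real (norm f)) \<le> norm (T x - f)"
    using transposition_weak_star_cluster_point[OF X Y T' f(1)] by blast
  have "norm T \<le> norm g"
  proof (rule field_le_epsilon)
    fix e :: real assume "e > 0"
    then obtain x where x: "norm x \<le> 1" "norm (T x - f) < e"
      using f(3) by (auto simp: closure_approachable dist_norm)
    \<comment> \<open>The last term is below \<open>e\<close> by the choice of \<open>x\<close>, and
      \<open>norm (g x) \<le> norm g\<close> on the unit ball.\<close>
    have "norm f \<le> norm (g x) + norm (g x - of_real (norm f))"
      using norm_triangle_ineq4[of "g x" "g x - of_real (norm f)"] by simp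
    with g(3)[of x] x norm_blinfun_le_on_cball[OF x(1), of g] f(2)
    show "norm T \<le> norm g + e" by linarith
  qed
  with g have "weak_star_quasi_attains_towards sX (transposition T) g"
    by (simp add: weak_star_quasi_attains_towards_def in_weak_star_closure_iff)
  then show ?thesis
    using transposition_in_bounded_ops[OF X Y T']
    by (auto simp: weak_star_QNA_def weak_star_quasi_attains_towards_def)
qed

text \<open>Forwards, the limiting functional is formed for the transposition, whose own
  transposition is \<open>T\<close>. Backwards, evaluation at a vector norming \<open>g\<close> is
  weak-star continuous and carries a bound from the image of \<open>T\<close> to
  \<open>g\<close>.\<close>

lemma transposition_NA_iff:
  fixes sX :: "'k::real_or_complex \<Rightarrow> 'x::real_normed_vector \<Rightarrow> 'x"
    and sY :: "'k \<Rightarrow> 'y::real_normed_vector \<Rightarrow> 'y"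
  assumes X: "normed_space_over sX" and Y: "normed_space_over sY"
    and T: "T \<in> bounded_ops sX (dual sY) dual_scale"
  shows "transposition T \<in> NA sY (dual sX) dual_scale \<longleftrightarrow>
    (\<exists>g \<in> NA sY UNIV (*). weak_star_quasi_attains_towards sY T g)"
proof
  let ?S = "transposition T"
  have S: "?S \<in> bounded_ops sY (dual sX) dual_scale"
    by (rule transposition_in_bounded_ops[OF X Y T])
  {
    assume "?S \<in> NA sY (dual sX) dual_scale"
    then obtain y where y: "norm y \<le> 1" "norm (?S y) = norm T"
      by (auto simp: NA_def)
    have "?S y \<in> dual sX" using S by (auto simp: bounded_ops_def)
    \<comment> \<open>For the functional \<open>?S y\<close> and the point \<open>y\<close> the
      error term vanishes, which forces \<open>g y\<close> to be
      \<open>of_real (norm T)\<close>.\<close>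
    then obtain g where g: "g \<in> weak_star_topology sY closure_of (blinfun_apply T ` cball 0 1)"
      "norm g \<le> norm T" "norm (g y - of_real (norm (?S y))) \<le> norm (?S y - ?S y)"
      using transposition_weak_star_cluster_point[OF Y X S]
      by (metis transposition_transposition norm_transposition)
    from g(3) y have "norm (g y) = norm T" by simp
    moreover from this have "norm g = norm T"
      using g(2) norm_blinfun_le_on_cball[OF y(1), of g] by simp
    moreover have "g \<in> dual sY" using g(1) by (simp add: in_weak_star_closure_iff)
    ultimately show "\<exists>g \<in> NA sY UNIV (*). weak_star_quasi_attains_towards sY T g"
      using g(1) y(1)
      by (intro bexI[of _ g])
        (auto simp: weak_star_quasi_attains_towards_def NA_def dual_def intro!: bexI[of _ y])
  }
  assume "\<exists>g \<in> NA sY UNIV (*). weak_star_quasi_attains_towards sY T g"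
  then obtain g :: "'y \<Rightarrow>\<^sub>L 'k" and y where y: "norm y \<le> 1" "norm (g y) = norm T"
    and g: "g \<in> weak_star_topology sY closure_of (blinfun_apply T ` cball 0 1)"
    by (auto simp: NA_def weak_star_quasi_attains_towards_def)
  \<comment> \<open>Since \<open>T x y\<close> is \<open>?S y x\<close>, this closed condition holds
    for every \<open>T x\<close> with \<open>x\<close> in the unit ball, hence for
    \<open>g\<close>.\<close>
  let ?C = "{k. norm (k y) \<le> norm (?S y)}"
  have "closed ?C"
    by (intro closed_Collect_le continuous_intros continuous_on_product_coordinates)
  moreover have "blinfun_apply ` (blinfun_apply T ` cball 0 1 \<inter> dual sY) \<subseteq> ?C"
    using norm_blinfun_le_on_cball[of _ "?S y"] by (auto simp: transposition_apply)
  ultimately have "blinfun_apply g \<in> ?C"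
    using g closure_minimal unfolding in_weak_star_closure_iff by blast
  \<comment> \<open>The chain is
    \<open>norm T = norm (g y) \<le> norm (?S y) \<le> norm ?S = norm T\<close>.\<close>
  with y norm_blinfun_le_on_cball[OF y(1), of ?S] have "norm (?S y) = norm ?S" by simp
  with y(1) S show "?S \<in> NA sY (dual sX) dual_scale"
    by (auto simp: NA_def intro!: bexI[of _ y])
qed

theorem proposition3p7:
  fixes sX :: "'k::real_or_complex \<Rightarrow> 'x::banach \<Rightarrow> 'x"
    and sY :: "'k \<Rightarrow> 'y::banach \<Rightarrow> 'y"
    and T :: "'x \<Rightarrow>\<^sub>L ('y \<Rightarrow>\<^sub>L 'k)"
  assumes "normed_space_over sX" and "normed_space_over sY"
    and "T \<in> bounded_ops sX (dual sY) dual_scale"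
  shows "(T \<in> QNA sX (dual sY) dual_scale \<longrightarrow> transposition T \<in> weak_star_QNA sY sX) \<and>
    (transposition T \<in> NA sY (dual sX) dual_scale \<longleftrightarrow>
       (\<exists>g \<in> NA sY UNIV (*). weak_star_quasi_attains_towards sY T g)) \<and>
    (separable_space (euclidean :: 'y topology) \<longrightarrow>
       transposition T \<in> QNA sY (dual sX) dual_scale \<longrightarrow> T \<in> weak_star_QNA sX sY)"
  using QNA_imp_transposition_weak_star_QNA[OF assms(1,2), of T]
    QNA_imp_transposition_weak_star_QNA[OF assms(2,1), of "transposition T"]
    transposition_NA_iff[OF assms]
  by simp

end
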